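(* The number $B(n)$ of prime 2-ball juggling patterns of period $n$ containing the state $\langle1,1\rangle$ satisfies $B(n)\sim\gamma_B2^n$ as $n\to\infty$, where $$\gamma_B=\frac32\sum_{t=1}^\infty\frac{t\,q_t}{2^t}=\frac34\sum_{t=1}^\infty t\left(\frac1{2^t}\prod_{i=2}^t\frac{i-1}{2^i-i-1}\right).$$
   Context: A 2-ball juggling state is a sequence $\alpha=(\alpha_1,\alpha_2,\dots)$ with $\alpha_i\in\{0,1\}$, finitely many nonzero, $\sum_i\alpha_i=2$. There is a transition $\alpha\to\beta$ iff $\alpha_{i+1}\le\beta_i$ for all $i\ge1$. A prime 2-ball juggling pattern of period $n$ is a directed cycle of length $n$ in this state graph, counted up to cyclic rotation. $\langle1,1\rangle=(1,1,0,0,\dots)$. $q_t=\frac12\prod_{i=2}^t\frac{i-1}{2^i-i-1}$. *)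

theory Defs
  imports Complex_Main "HOL-Library.Landau_Symbols" "Graph_Theory.Pair_Digraph"
begin

text \<open>
  Sequences are indexed from 0 here: the value at \<open>i\<close> is the entry
  \<open>\<alpha>\<close> with index \<open>i + 1\<close> in the usual 1-based numbering.
\<close>

definition juggling_states :: "(nat \<Rightarrow> nat) set" where
  "juggling_states =
     {\<alpha>. (\<forall>i. \<alpha> i \<in> {0, 1}) \<and> finite {i. \<alpha> i \<noteq> 0} \<and> (\<Sum>i | \<alpha> i \<noteq> 0. \<alpha> i) = 2}"

definition juggling_graph :: "(nat \<Rightarrow> nat) pair_pre_digraph" where
  "juggling_graph =
     \<lparr> pverts = juggling_states,
       parcs = {(\<alpha>, \<beta>). \<alpha> \<in> juggling_states \<and> \<beta> \<in> juggling_states \<and>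
                         (\<forall>i. \<alpha> (Suc i) \<le> \<beta> i)} \<rparr>"

definition ground_state :: "nat \<Rightarrow> nat" where
  "ground_state = (\<lambda>i. if i < 2 then 1 else 0)"

type_synonym state_walk = "((nat \<Rightarrow> nat) \<times> (nat \<Rightarrow> nat)) list"

definition rotation_rel :: "(state_walk \<times> state_walk) set" where
  "rotation_rel = {(p, p'). \<exists>k. p' = rotate k p}"

text \<open>
  The library represents a cycle by its nonempty list of arcs, starting at some
  chosen vertex, with pairwise distinct vertices; loops count as cycles of length 1.
  A pattern is a class of such lists modulo rotation.
\<close>

definition prime_patterns :: "nat \<Rightarrow> state_walk set set" where
  "prime_patterns n =
     {p. pre_digraph.cycle (with_proj juggling_graph) p \<and> length p = n} // rotation_rel"

text \<open>The states visited by a cycle are the tails of its arcs.\<close>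

definition pattern_states :: "state_walk set \<Rightarrow> (nat \<Rightarrow> nat) set" where
  "pattern_states P = (\<Union>p\<in>P. fst ` set p)"

definition B :: "nat \<Rightarrow> nat" where
  "B n = card {P \<in> prime_patterns n. ground_state \<in> pattern_states P}"

definition q :: "nat \<Rightarrow> real" where
  "q t = 1 / 2 * (\<Prod>i=2..t. (real i - 1) / (2 ^ i - real i - 1))"

text \<open>The summation index \<open>t \<ge> 1\<close> is written as \<open>Suc t\<close>.\<close>

definition gamma_B :: real where
  "gamma_B = 3 / 2 * (\<Sum>t. real (Suc t) * q (Suc t) / 2 ^ Suc t)"

end

theory Submission
  imports Defs "HOL-Analysis.Uniform_Limit"
begin

text \<open>
  Record a state by the pair \<open>(i, d)\<close> of the first ball position \<open>i\<close> (counted from 0) and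
  the distance \<open>d > 0\<close> to the second ball. The distance only changes at a throw, that is when
  \<open>i = 0\<close>. A prime cycle is therefore a cyclic sequence of distinct distances; the passage from
  \<open>d\<close> to \<open>e\<close> takes \<open>d\<close> steps, or, if \<open>e < d\<close>, alternatively \<open>d - e\<close> steps. Grouping
  the distances along the short passages gives decreasing blocks, and the period telescopes to the
  sum of the block maxima. Thus the cycles through the ground state are the sequences of disjoint
  nonempty finite sets of positive integers, the last of which contains 1, whose maxima sum to \<open>n\<close>.
  Let \<open>G\<^sub>t(n)\<close> be the number of such sequences of length \<open>t\<close> without the condition on
  the number 1. Deleting 1 and shifting down yields
  \<open>G\<^sub>t(n + t) = (t + 1) G\<^sub>t(n) + t G\<^sub>t\<^sub>-\<^sub>1(n)\<close>. By this recurrence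
  \<open>G\<^sub>t(n) / 2\<^sup>n\<close> increases with \<open>n\<close> (for \<open>t > 0\<close>) to the limit \<open>t q\<^sub>t\<close>, and
  Tannery's theorem applied to
  \<open>B(n) = \<Sum>\<^sub>t (G\<^sub>t(n - t) + G\<^sub>t\<^sub>-\<^sub>1(n - t))\<close> gives the constant.
\<close>

subsection \<open>Prime patterns through the ground state\<close>

text \<open>Distance 0 would merge the two balls into one, hence the recurring hypothesis
  \<open>snd s > 0\<close>.\<close>

definition state :: "nat \<times> nat \<Rightarrow> nat \<Rightarrow> nat" where
  "state s = (\<lambda>k. if k = fst s \<or> k = fst s + snd s then 1 else 0)"

lemma state_in_juggling_states:
  assumes "snd s > 0" shows "state s \<in> juggling_states"
proof -
  have "{i. state s i \<noteq> 0} = {fst s, fst s + snd s}" by (auto simp: state_def)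
  moreover have "(\<Sum>i\<in>{fst s, fst s + snd s}. state s i) = 2"
    using assms by (simp add: state_def)
  ultimately show ?thesis by (simp add: juggling_states_def) (simp add: state_def)
qed

lemma juggling_statesE:
  assumes "\<alpha> \<in> juggling_states" obtains s where "snd s > 0" "\<alpha> = state s"
proof -
  have \<alpha>: "\<alpha> i \<in> {0, 1}" "finite {i. \<alpha> i \<noteq> 0}" "(\<Sum>i | \<alpha> i \<noteq> 0. \<alpha> i) = 2" for i
    using assms by (auto simp: juggling_states_def)
  have "(\<Sum>i | \<alpha> i \<noteq> 0. \<alpha> i) = (\<Sum>i | \<alpha> i \<noteq> 0. 1)"
  proof (rule sum.cong)
    fix i assume "i \<in> {i. \<alpha> i \<noteq> 0}"
    then show "\<alpha> i = 1" using \<alpha>(1)[of i] by simp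
  qed simp
  then have "card {i. \<alpha> i \<noteq> 0} = 2" using \<alpha>(3) by simp
  then obtain x y where "{i. \<alpha> i \<noteq> 0} = {x, y}" "x \<noteq> y" unfolding card_2_iff by blast
  then have "{i. \<alpha> i \<noteq> 0} = {min x y, max x y}" "min x y < max x y" by (auto simp: min_def max_def)
  then obtain a b where ab: "{i. \<alpha> i \<noteq> 0} = {a, b}" "a < b" by blast
  have "\<alpha> i = state (a, b - a) i" for i
  proof -
    have "\<alpha> i \<noteq> 0 \<longleftrightarrow> i = a \<or> i = b" using ab(1) by blast
    then show ?thesis using \<alpha>(1)[of i] \<open>a < b\<close> by (auto simp: state_def)
  qed
  then have "\<alpha> = state (a, b - a)" by (rule ext)
  then show ?thesis using \<open>a < b\<close> that[of "(a, b - a)"] by simp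
qed

lemma juggling_states_eq: "juggling_states = state ` {s. snd s > 0}"
  using state_in_juggling_states by (auto elim: juggling_statesE)

lemma state_inject:
  assumes "snd s > 0" "snd s' > 0" "state s = state s'" shows "s = s'"
proof -
  have "{fst s, fst s + snd s} = {fst s', fst s' + snd s'}"
  proof -
    have "{i. state s i \<noteq> 0} = {fst s, fst s + snd s}" for s by (auto simp: state_def)
    then show ?thesis using assms(3) by metis
  qed
  then show ?thesis using assms by (auto simp: doubleton_eq_iff prod_eq_iff)
qed

lemma ground_state_eq: "ground_state = state (0, 1)"
  by (auto simp: ground_state_def state_def fun_eq_iff)

text \<open>For \<open>i = 0\<close> the remaining ball drops to position \<open>d - 1\<close>,
  where it is the first ball of the new state (\<open>j = d - 1\<close>) or the second
  (\<open>j + e = d - 1\<close>); the other ball is the thrown one.\<close>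

fun step :: "nat \<times> nat \<Rightarrow> nat \<times> nat \<Rightarrow> bool" where
  "step (i, d) (j, e) \<longleftrightarrow>
     e > 0 \<and> (if i = 0 then j = d - 1 \<or> j + e = d - 1 else j = i - 1 \<and> e = d)"

lemma arc_iff_step:
  assumes "snd s > 0" "snd s' > 0"
  shows "(state s, state s') \<in> parcs juggling_graph \<longleftrightarrow> step s s'"
proof -
  obtain i d j e where s: "s = (i, d)" "s' = (j, e)" by (metis surj_pair)
  have *: "d > 0" "e > 0" using assms s by auto
  have "(\<forall>k. state s (Suc k) \<le> state s' k) \<longleftrightarrow>
      (\<forall>k. Suc k = i \<or> Suc k = i + d \<longrightarrow> k = j \<or> k = j + e)"
    by (auto simp: state_def s)
  also have "\<dots> \<longleftrightarrow> step s s'"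
  proof (cases i)
    case 0
    have "(\<forall>k. Suc k = i \<or> Suc k = i + d \<longrightarrow> k = j \<or> k = j + e) \<longleftrightarrow> d - 1 = j \<or> d - 1 = j + e"
      using 0 * by (metis Suc_pred' add_0 diff_Suc_1 nat.distinct(1))
    then show ?thesis using 0 * by (auto simp: s)
  next
    case (Suc m)
    have "(\<forall>k. Suc k = i \<or> Suc k = i + d \<longrightarrow> k = j \<or> k = j + e) \<longleftrightarrow>
        (m = j \<or> m = j + e) \<and> (m + d = j \<or> m + d = j + e)"
      using Suc by auto
    \<comment> \<open>Both balls survive, and as \<open>d\<close> and \<open>e\<close> are positive
      the order of the positions leaves only one matching.\<close>
    also have "\<dots> \<longleftrightarrow> j = m \<and> e = d" using * by arith
    finally show ?thesis using Suc * by (simp add: s)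
  qed
  finally show ?thesis
    using assms by (simp add: juggling_graph_def state_in_juggling_states)
qed

section \<open>Cycles as arc lists and their rotations\<close>

definition cycles :: "nat \<Rightarrow> state_walk set" where
  "cycles n = {p. pre_digraph.cycle (with_proj juggling_graph) p \<and> length p = n}"

text \<open>The library asks for distinct vertices after dropping the first vertex of the walk; on a
  nonempty walk these are the heads of its arcs.\<close>

lemma cycle_iff:
  "pre_digraph.cycle (with_proj juggling_graph) p \<longleftrightarrow>
     p \<noteq> [] \<and> set p \<subseteq> parcs juggling_graph \<and> pcas (fst (hd p)) p (fst (hd p)) \<and>
     distinct (map snd p)"
proof (cases p)
  case (Cons a p')
  have "tl (pawalk_verts u p) = map snd p" if "pcas u p u" for u
    using pre_digraph.awalk_verts_conv'[of "with_proj juggling_graph" u p u] that Cons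
    unfolding cas_with_proj_eq awalk_verts_with_proj_eq by simp
  moreover have "fst a \<in> pverts juggling_graph" if "a \<in> parcs juggling_graph"
    using that by (auto simp: juggling_graph_def)
  ultimately show ?thesis
    unfolding pre_digraph.cycle_def pre_digraph.awalk_def cas_with_proj_eq
      awalk_verts_with_proj_eq with_proj_simps using Cons by (auto simp del: pawalk_verts.simps list.map)
qed (simp add: pre_digraph.cycle_def)

lemma pcas_append: "pcas u (p @ p') v \<longleftrightarrow> (\<exists>w. pcas u p w \<and> pcas w p' v)"
  by (induction p arbitrary: u) auto

lemma rotate_in_cycles:
  assumes "p \<in> cycles n" shows "rotate k p \<in> cycles n"
proof -
  have "rotate1 p \<in> cycles n" if "p \<in> cycles n" for p
    using that by (cases p; cases "tl p") (auto simp: cycles_def cycle_iff pcas_append)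
  then show ?thesis using assms by (induction k) auto
qed

text \<open>On a closed walk the tails of the arcs are a permutation of the heads.\<close>

lemma distinct_fst_if_cycle:
  assumes "p \<in> cycles n" shows "distinct (map fst p)"
proof -
  have pcas_fst: "map fst p @ [v] = u # map snd p" if "pcas u p v" for u v p
    using that by (induction p arbitrary: u) auto
  let ?u = "fst (hd p)"
  have p: "pcas ?u p ?u" "distinct (map snd p)"
    using assms by (auto simp: cycles_def cycle_iff)
  have "mset (map fst p @ [?u]) = mset (?u # map snd p)" using pcas_fst[OF p(1)] by simp
  then have "mset (map fst p) = mset (map snd p)" by (simp del: mset_map)
  then show ?thesis using p(2) mset_eq_imp_distinct_iff by blast
qed

lemma rotation_rel_equiv: "equiv UNIV rotation_rel"
proof (rule equivI)
  show "rotation_rel \<subseteq> UNIV \<times> UNIV" by simp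
  show "refl rotation_rel"
    by (auto simp: refl_on_def rotation_rel_def intro: exI[of _ 0])
  show "sym rotation_rel"
  proof (rule symI)
    fix p p' assume "(p, p') \<in> rotation_rel"
    then obtain k where k: "p' = rotate k p" by (auto simp: rotation_rel_def)
    \<comment> \<open>The complementary rotation undoes the given one; \<open>k\<close> is reduced
      modulo the length first because the subtraction is truncated.\<close>
    have "rotate (length p - k mod length p) p' = rotate (length p - k mod length p + k) p"
      by (simp add: k rotate_rotate)
    also have "\<dots> = rotate ((length p - k mod length p + k mod length p) mod length p) p"
      by (metis mod_add_right_eq rotate_conv_mod)
    also have "\<dots> = p"
      by (cases "p = []") (simp_all add: less_imp_le)
    finally show "(p', p) \<in> rotation_rel" unfolding rotation_rel_def by (auto intro: exI sym)
  qed
  show "trans rotation_rel"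
    by (auto simp: trans_def rotation_rel_def rotate_rotate)
qed

text \<open>A cycle leaves the ground state at most once, so each pattern through it has exactly one
  representative that starts there.\<close>

lemma B_eq_card_cycles: "B n = card {p \<in> cycles n. fst (hd p) = ground_state}"
proof -
  let ?C = "{p \<in> cycles n. fst (hd p) = ground_state}"
  have "bij_betw (\<lambda>p. rotation_rel `` {p}) ?C
      {P \<in> prime_patterns n. ground_state \<in> pattern_states P}"
    unfolding bij_betw_def
  proof
    show "inj_on (\<lambda>p. rotation_rel `` {p}) ?C"
    proof (rule inj_onI)
      fix p p' assume p: "p \<in> ?C" "p' \<in> ?C" and "rotation_rel `` {p} = rotation_rel `` {p'}"
      then have "(p, p') \<in> rotation_rel"
        using eq_equiv_class[OF _ rotation_rel_equiv] by blast
      then obtain k where k: "p' = rotate k p" by (auto simp: rotation_rel_def)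
      have ne: "p \<noteq> []" using p by (auto simp: cycles_def cycle_iff)
      have "hd p' = p ! (k mod length p)" unfolding k by (rule hd_rotate_conv_nth[OF ne])
      moreover have "hd p = p ! 0" using ne by (rule hd_conv_nth)
      moreover have "fst (hd p') = fst (hd p)" using p by simp
      moreover have "k mod length p < length p" "0 < length p" using ne by simp_all
      moreover have "distinct (map fst p)" using p distinct_fst_if_cycle by blast
      ultimately have "k mod length p = 0"
        using nth_eq_iff_index_eq[of "map fst p" "k mod length p" 0] by simp
      then show "p = p'" using k by (metis rotate0 rotate_conv_mod id_apply)
    qed
    show "(\<lambda>p. rotation_rel `` {p}) ` ?C =
        {P \<in> prime_patterns n. ground_state \<in> pattern_states P}"
    proof (intro equalityI subsetI)
      fix P assume "P \<in> (\<lambda>p. rotation_rel `` {p}) ` ?C"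
      then obtain p where p: "p \<in> ?C" "P = rotation_rel `` {p}" by blast
      then have "p \<noteq> []" by (auto simp: cycles_def cycle_iff)
      then have "ground_state \<in> fst ` set p" using p by (metis (mono_tags) hd_in_set imageI mem_Collect_eq)
      moreover have "p \<in> P" using equiv_class_self[OF rotation_rel_equiv] p by blast
      ultimately show "P \<in> {P \<in> prime_patterns n. ground_state \<in> pattern_states P}"
        using p by (auto simp: prime_patterns_def pattern_states_def cycles_def intro: quotientI)
    next
      fix P assume "P \<in> {P \<in> prime_patterns n. ground_state \<in> pattern_states P}"
      then obtain p p' where p: "p \<in> cycles n" "P = rotation_rel `` {p}" "p' \<in> P"
        "ground_state \<in> fst ` set p'"
        by (auto simp: prime_patterns_def pattern_states_def cycles_def elim!: quotientE)
      then have p': "p' \<in> cycles n" by (auto simp: rotation_rel_def rotate_in_cycles)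
      obtain k where k: "k < length p'" "fst (p' ! k) = ground_state"
        using p(4) by (auto simp: in_set_conv_nth)
      have "rotate k p' \<in> ?C"
        using k rotate_in_cycles[OF p'] by (cases "p' = []") (auto simp: hd_rotate_conv_nth)
      moreover have "(p, p') \<in> rotation_rel" using p by blast
      then have "(p, rotate k p') \<in> rotation_rel"
        by (auto simp: rotation_rel_def rotate_rotate)
      then have "P = rotation_rel `` {rotate k p'}"
        using p(2) equiv_class_eq[OF rotation_rel_equiv] by simp
      ultimately show "P \<in> (\<lambda>p. rotation_rel `` {p}) ` ?C" by blast
    qed
  qed
  then show ?thesis by (simp add: B_def bij_betw_same_card)
qed

section \<open>Closed walks on pairs of position and distance\<close>

primrec walk :: "nat \<times> nat \<Rightarrow> (nat \<times> nat) list \<Rightarrow> bool" where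
  "walk s [] \<longleftrightarrow> True"
| "walk s (v # vs) \<longleftrightarrow> step s v \<and> walk v vs"

primrec arcs_from :: "'a \<Rightarrow> 'a list \<Rightarrow> ('a \<times> 'a) list" where
  "arcs_from u [] = []"
| "arcs_from u (v # vs) = (u, v) # arcs_from v vs"

lemma map_snd_arcs_from: "map snd (arcs_from u vs) = vs"
  by (induction vs arbitrary: u) auto

lemma pcas_arcs_from: "pcas u (arcs_from u vs) v \<longleftrightarrow> last (u # vs) = v"
  by (induction vs arbitrary: u) auto

lemma arcs_from_map_snd: "pcas u p v \<Longrightarrow> arcs_from u (map snd p) = p"
  by (induction p arbitrary: u) auto

lemma step_snd_pos: "step s v \<Longrightarrow> snd v > 0"
  by (cases s; cases v) auto

lemma walk_snd_pos: "walk s vs \<Longrightarrow> \<forall>v\<in>set vs. snd v > 0"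
  by (induction vs arbitrary: s) (auto dest: step_snd_pos)

lemma arcs_from_subset_arcs:
  assumes "\<forall>v\<in>set vs. snd v > 0" "snd s > 0"
  shows "set (arcs_from (state s) (map state vs)) \<subseteq> parcs juggling_graph \<longleftrightarrow> walk s vs"
  using assms by (induction vs arbitrary: s) (auto simp: arc_iff_step)

text \<open>The start \<open>(0, 1)\<close> is not listed but recurs as the last entry, so
  distinctness of the list is distinctness of the vertices of the cycle.\<close>

definition ground_walks :: "nat \<Rightarrow> (nat \<times> nat) list set" where
  "ground_walks n =
     {vs. walk (0, 1) vs \<and> vs \<noteq> [] \<and> last vs = (0, 1) \<and> distinct vs \<and> length vs = n}"

lemma inj_on_state: "\<forall>v\<in>V. snd v > 0 \<Longrightarrow> inj_on state V"
  by (intro inj_onI) (blast intro: state_inject)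

text \<open>Once the start is fixed, a walk is determined by the heads of its arcs, and
  \<open>state\<close> is injective on pairs with positive distance.\<close>

lemma card_cycles_eq_ground_walks:
  "card {p \<in> cycles n. fst (hd p) = ground_state} = card (ground_walks n)"
proof -
  let ?f = "\<lambda>vs. arcs_from ground_state (map state vs)"
  have len: "length (arcs_from u vs) = length vs" for u :: 'a and vs
    by (induction vs arbitrary: u) auto
  have "bij_betw ?f (ground_walks n) {p \<in> cycles n. fst (hd p) = ground_state}"
    unfolding bij_betw_def
  proof
    show "inj_on ?f (ground_walks n)"
    proof (rule inj_onI)
      fix vs vs' assume vs: "vs \<in> ground_walks n" "vs' \<in> ground_walks n" and "?f vs = ?f vs'"
      then have "map state vs = map state vs'" by (metis map_snd_arcs_from)
      moreover have "inj_on state (set vs \<union> set vs')"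
        using vs walk_snd_pos by (intro inj_on_state) (auto simp: ground_walks_def)
      ultimately show "vs = vs'" by (metis inj_on_map_eq_map)
    qed
    show "?f ` ground_walks n = {p \<in> cycles n. fst (hd p) = ground_state}"
    proof (intro equalityI subsetI)
      fix p assume "p \<in> ?f ` ground_walks n"
      then obtain vs where vs: "vs \<in> ground_walks n" "p = ?f vs" by blast
      have pos: "\<forall>v\<in>set vs. snd v > 0" using vs walk_snd_pos by (auto simp: ground_walks_def)
      have "hd p = (ground_state, state (hd vs))" "p \<noteq> []"
        using vs by (cases vs; simp add: ground_walks_def)+
      moreover have "set p \<subseteq> parcs juggling_graph"
        using arcs_from_subset_arcs[OF pos, of "(0, 1)"] vs by (simp add: ground_walks_def ground_state_eq)
      moreover have "pcas ground_state p ground_state"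
        using vs by (auto simp: pcas_arcs_from ground_walks_def ground_state_eq last_map)
      moreover have "distinct (map snd p)"
        using vs inj_on_state[OF pos] by (simp add: map_snd_arcs_from distinct_map ground_walks_def)
      ultimately show "p \<in> {p \<in> cycles n. fst (hd p) = ground_state}"
        using vs by (auto simp: cycles_def cycle_iff ground_walks_def) (auto simp: len)
    next
      fix p assume "p \<in> {p \<in> cycles n. fst (hd p) = ground_state}"
      then have p: "p \<noteq> []" "set p \<subseteq> parcs juggling_graph" "pcas ground_state p ground_state"
        "distinct (map snd p)" "length p = n"
        by (auto simp: cycles_def cycle_iff)
      have "map snd p \<in> lists (state ` {s. snd s > 0})"
      proof -
        have "snd a \<in> juggling_states" if "a \<in> parcs juggling_graph" for a
          using that by (auto simp: juggling_graph_def)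
        then have "\<forall>a\<in>set p. snd a \<in> juggling_states" using p(2) by blast
        then show ?thesis unfolding juggling_states_eq in_lists_conv_set by simp
      qed
      then obtain vs where vs: "map snd p = map state vs" "set vs \<subseteq> {s. snd s > 0}"
        unfolding lists_image by blast
      have pf: "p = ?f vs" using arcs_from_map_snd[OF p(3)] vs(1) by simp
      have "walk (0, 1) vs"
        using arcs_from_subset_arcs[of vs "(0, 1)"] p(2) vs(2) unfolding pf
        by (auto simp: ground_state_eq)
      moreover have "vs \<noteq> []" using p(1) vs(1) by auto
      moreover have "last vs = (0, 1)"
      proof (rule state_inject)
        show "snd (last vs) > 0" using vs(2) \<open>vs \<noteq> []\<close> last_in_set by blast
        show "state (last vs) = state (0, 1)"
          using p(3) \<open>vs \<noteq> []\<close> unfolding pf by (simp add: pcas_arcs_from last_map ground_state_eq)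
      qed simp
      moreover have "distinct vs" using p(4) vs(1) by (simp add: distinct_map)
      moreover have "length vs = n" using p(5) vs(1) by (metis length_map)
      ultimately show "p \<in> ?f ` ground_walks n" using pf by (auto simp: ground_walks_def)
    qed
  qed
  then show ?thesis by (simp add: bij_betw_same_card)
qed

subsection \<open>Counting arrangements of decreasing blocks\<close>

text \<open>A finite set is stored as its decreasing list, so that \<open>hd\<close> is its maximum
  and disjointness of the sets becomes distinctness of the concatenation.\<close>

definition arrangements :: "nat \<Rightarrow> nat \<Rightarrow> nat list list set" where
  "arrangements t n =
     {xss. length xss = t \<and> (\<forall>l\<in>set xss. l \<noteq> [] \<and> sorted_wrt (>) l) \<and>
           distinct (concat xss) \<and> 0 \<notin> set (concat xss) \<and> sum_list (map hd xss) = n}"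

definition arrangements_above_1 :: "nat \<Rightarrow> nat \<Rightarrow> nat list list set" where
  "arrangements_above_1 t n = {xss \<in> arrangements t n. 1 \<notin> set (concat xss)}"

lemma le_hd_if_decreasing:
  assumes "sorted_wrt (>) (l :: nat list)" "x \<in> set l"
  shows "x \<le> hd l"
  using assms by (cases l) (auto intro: less_imp_le)

lemma sum_list_Suc: "sum_list (map (\<lambda>x. Suc (f x)) xs) = sum_list (map f xs) + length xs"
  by (induction xs) auto

text \<open>Every entry is at most the maximum of its block, hence at most \<open>n\<close>.\<close>

lemma finite_arrangements: "finite (arrangements t n)"
proof (rule finite_subset)
  show "arrangements t n \<subseteq> {xss. set xss \<subseteq> {l. set l \<subseteq> {..n} \<and> distinct l} \<and> length xss = t}"
  proof safe
    fix xss l assume xss: "xss \<in> arrangements t n" and l: "l \<in> set xss"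
    then show "distinct l"
      by (auto simp: arrangements_def distinct_concat_iff)
    fix x assume x: "x \<in> set l"
    have "x \<le> hd l"
      using xss l x le_hd_if_decreasing by (auto simp: arrangements_def)
    also have "\<dots> \<le> sum_list (map hd xss)"
      using l by (intro member_le_sum_list) auto
    finally show "x \<le> n"
      using xss by (simp add: arrangements_def)
  qed (auto simp: arrangements_def)
  show "finite {xss. set xss \<subseteq> {l. set l \<subseteq> {..n} \<and> distinct l} \<and> length xss = t}"
    by (intro finite_lists_length_eq finite_subset_distinct) auto
qed

text \<open>Each block contributes a maximum of at least 1.\<close>

lemma arrangements_empty:
  assumes "n < t" shows "arrangements t n = {}"
proof -
  have "length xss \<le> sum_list (map hd xss)"
    if "\<forall>l\<in>set xss. l \<noteq> []" "0 \<notin> set (concat xss)" for xss :: "nat list list"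
    using that
  proof (induction xss)
    case (Cons l xss)
    then have "hd l \<noteq> 0" by (cases l) auto
    then show ?case using Cons by auto
  qed simp
  then show ?thesis using assms by (fastforce simp: arrangements_def)
qed

lemma arrangements_0: "arrangements 0 n = (if n = 0 then {[]} else {})"
  by (auto simp: arrangements_def)

text \<open>Raising every entry by one frees the value 1 and raises each of the \<open>t\<close>
  maxima by one.\<close>

lemma card_arrangements_above_1: "card (arrangements_above_1 t (n + t)) = card (arrangements t n)"
proof -
  have "inj (map (map Suc))" by (intro inj_mapI inj_Suc)
  moreover have "map (map Suc) ` arrangements t n = arrangements_above_1 t (n + t)"
  proof (intro equalityI subsetI)
    fix yss assume "yss \<in> map (map Suc) ` arrangements t n"
    then obtain xss where xss: "xss \<in> arrangements t n" "yss = map (map Suc) xss" by blast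
    have "sum_list (map (hd \<circ> map Suc) xss) = sum_list (map (\<lambda>l. Suc (hd l)) xss)"
      using xss by (intro arg_cong[where f = sum_list] map_cong) (auto simp: hd_map arrangements_def)
    also have "\<dots> = n + t"
      using xss by (simp add: sum_list_Suc arrangements_def)
    finally show "yss \<in> arrangements_above_1 t (n + t)"
      using xss by (auto simp: arrangements_above_1_def arrangements_def sorted_wrt_map
          distinct_map simp flip: map_concat)
  next
    fix yss assume "yss \<in> arrangements_above_1 t (n + t)"
    then have yss: "yss \<in> arrangements t (n + t)" "1 \<notin> set (concat yss)"
      by (auto simp: arrangements_above_1_def)
    define xss where "xss = map (map (\<lambda>x. x - 1)) yss"
    have z: "0 \<notin> set (concat yss)" using yss(1) unfolding arrangements_def by fast
    have pos: "x > 1" if "l \<in> set yss" "x \<in> set l" for l x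
    proof -
      have "x \<in> set (concat yss)" using that by auto
      then have "x \<noteq> 0" "x \<noteq> 1" using yss(2) z by metis+
      then show ?thesis by simp
    qed
    have eq: "yss = map (map Suc) xss"
    proof -
      have "map Suc (map (\<lambda>x. x - 1) l) = l" if "l \<in> set yss" for l
        unfolding map_map using pos[OF that] by (intro map_idI) fastforce
      then have "map (\<lambda>l. map Suc (map (\<lambda>x. x - 1) l)) yss = yss" by (rule map_idI)
      then show ?thesis by (simp only: xss_def map_map comp_def)
    qed
    have "distinct (concat xss)"
      using yss(1) unfolding arrangements_def eq by (simp add: distinct_map flip: map_concat)
    moreover have "sum_list (map hd xss) = n"
    proof -
      have ne: "l \<noteq> []" if "l \<in> set xss" for l
        using yss(1) that by (auto simp: arrangements_def eq)
      have "n + t = sum_list (map (hd \<circ> map Suc) xss)"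
        using yss(1) by (simp add: arrangements_def eq)
      also have "\<dots> = sum_list (map (\<lambda>l. Suc (hd l)) xss)"
        using ne by (intro arg_cong[where f = sum_list] map_cong) (auto simp: hd_map)
      also have "\<dots> = sum_list (map hd xss) + t"
        using yss(1) by (simp add: sum_list_Suc arrangements_def eq)
      finally show ?thesis by simp
    qed
    moreover have "0 \<notin> set (concat xss)"
      using pos by (fastforce simp: xss_def)
    ultimately have "xss \<in> arrangements t n"
      using yss(1) by (auto simp: arrangements_def eq sorted_wrt_map)
    then show "yss \<in> map (map Suc) ` arrangements t n" by (auto simp: eq)
  qed
  ultimately show ?thesis by (metis card_image inj_on_subset subset_UNIV)
qed

section \<open>Recurrence from deleting the entry 1\<close>

lemma last_eq_1_if_decreasing:
  assumes "sorted_wrt (>) l" "1 \<in> set l" "0 \<notin> set (l :: nat list)"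
  shows "last l = 1"
  using assms
proof (induction l rule: rev_induct)
  case (snoc x l)
  have "x \<noteq> 0" using snoc by auto
  then show ?case using snoc by (auto simp: sorted_wrt_append)
qed simp

text \<open>Appending the least admissible entry to a nonempty block keeps its head, so the sum of
  maxima does not change.\<close>

lemma append_1_in_arrangements:
  assumes "l \<noteq> []"
  shows "ys @ (l @ [1]) # zs \<in> arrangements t n \<longleftrightarrow> ys @ l # zs \<in> arrangements_above_1 t n"
proof -
  have "(\<forall>x\<in>set l. 1 < x) \<longleftrightarrow> 0 \<notin> set l \<and> 1 \<notin> set l"
    by (metis One_nat_def less_Suc0 less_one linorder_neqE_nat not_less_zero)
  then show ?thesis using assms
    unfolding arrangements_above_1_def arrangements_def by (auto simp: sorted_wrt_append)
qed

text \<open>The block \<open>[1]\<close> accounts for one block and for 1 in the sum; the conditions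
  on \<open>t\<close> and \<open>n\<close> make the truncated subtractions exact.\<close>

lemma singleton_1_in_arrangements:
  "ys @ [1] # zs \<in> arrangements t n \<longleftrightarrow>
     t \<noteq> 0 \<and> n \<noteq> 0 \<and> ys @ zs \<in> arrangements_above_1 (t - 1) (n - 1)"
  unfolding arrangements_above_1_def arrangements_def by auto

text \<open>Delete the 1 from block \<open>i\<close>. If other entries remain, the block keeps its
  maximum; if the block was \<open>[1]\<close>, it disappears and the sum drops by 1.\<close>

lemma card_1_in_block:
  assumes "i < t" "n > 0"
  shows "card {xss \<in> arrangements t n. 1 \<in> set (xss ! i)} =
    card (arrangements_above_1 t n) + card (arrangements_above_1 (t - 1) (n - 1))"
proof -
  define K where "K = {xss \<in> arrangements t n. 1 \<in> set (xss ! i)}"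
  \<comment> \<open>\<open>f\<close> and \<open>g\<close> are the insertions that invert the two
    kinds of deletion.\<close>
  define f where "f xss = take i xss @ (xss ! i @ [1]) # drop (Suc i) xss" for xss :: "nat list list"
  define g where "g xss = take i xss @ [1] # drop i xss" for xss :: "nat list list"
  have split: "\<exists>ys l zs. xss = ys @ l # zs \<and> length ys = i \<and> l \<noteq> [] \<and> sorted_wrt (>) l \<and> 0 \<notin> set l"
    if "xss \<in> arrangements t n" for xss
  proof -
    have len: "i < length xss" using that assms by (simp add: arrangements_def)
    then have "xss ! i \<in> set xss" by simp
    moreover have "length (take i xss) = i" using len by simp
    ultimately show ?thesis
      using id_take_nth_drop[OF len] that unfolding arrangements_def by fastforce
  qed
  have f_app: "f (ys @ l # zs) = ys @ (l @ [1]) # zs" if "length ys = i" for ys l zs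
    using that by (simp add: f_def nth_append)
  have "f ` arrangements_above_1 t n = {xss \<in> K. xss ! i \<noteq> [1]}"
  proof (intro equalityI subsetI)
    fix yss assume "yss \<in> f ` arrangements_above_1 t n"
    then obtain xss where xss: "xss \<in> arrangements_above_1 t n" "yss = f xss" by blast
    then have "xss \<in> arrangements t n" by (simp add: arrangements_above_1_def)
    from split[OF this] obtain ys l zs where s: "xss = ys @ l # zs" "length ys = i" "l \<noteq> []"
      by blast
    then show "yss \<in> {xss \<in> K. xss ! i \<noteq> [1]}"
      using xss append_1_in_arrangements[OF s(3)] by (auto simp: f_app K_def nth_append)
  next
    fix yss assume "yss \<in> {xss \<in> K. xss ! i \<noteq> [1]}"
    then have yss: "yss \<in> arrangements t n" "1 \<in> set (yss ! i)" "yss ! i \<noteq> [1]"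
      by (auto simp: K_def)
    from split[OF yss(1)] obtain ys l zs where s: "yss = ys @ l # zs" "length ys = i" "l \<noteq> []"
      "sorted_wrt (>) l" "0 \<notin> set l" by blast
    have l: "l = butlast l @ [1]"
      using s yss(2) last_eq_1_if_decreasing[OF s(4) _ s(5)] append_butlast_last_id[OF s(3)]
      by (simp add: nth_append)
    then have "butlast l \<noteq> []" using yss(3) s by (auto simp: nth_append)
    then have "ys @ butlast l # zs \<in> arrangements_above_1 t n"
      using yss(1) append_1_in_arrangements l s(1) by metis
    moreover have "yss = f (ys @ butlast l # zs)" using s l by (simp add: f_app)
    ultimately show "yss \<in> f ` arrangements_above_1 t n" by blast
  qed
  moreover have "inj_on f (arrangements_above_1 t n)"
  proof (rule inj_onI)
    fix xss yss assume "xss \<in> arrangements_above_1 t n" "yss \<in> arrangements_above_1 t n"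
      and eq: "f xss = f yss"
    then have "xss \<in> arrangements t n" "yss \<in> arrangements t n"
      by (auto simp: arrangements_above_1_def)
    then obtain ys l zs ys' l' zs' where s: "xss = ys @ l # zs" "length ys = i"
      "yss = ys' @ l' # zs'" "length ys' = i" using split by metis
    then show "xss = yss" using eq by (auto simp: f_app)
  qed
  ultimately have c1: "card {xss \<in> K. xss ! i \<noteq> [1]} = card (arrangements_above_1 t n)"
    by (metis card_image)
  have g_app: "g (ys @ zs) = ys @ [1] # zs" if "length ys = i" for ys zs
    using that by (simp add: g_def)
  have splitg: "\<exists>ys zs. xss = ys @ zs \<and> length ys = i"
    if "xss \<in> arrangements_above_1 (t - 1) (n - 1)" for xss
  proof -
    have "length (take i xss) = i"
      using that assms by (simp add: arrangements_above_1_def arrangements_def)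
    then show ?thesis by (metis append_take_drop_id)
  qed
  have "g ` arrangements_above_1 (t - 1) (n - 1) = {xss \<in> K. xss ! i = [1]}"
  proof (intro equalityI subsetI)
    fix yss assume "yss \<in> g ` arrangements_above_1 (t - 1) (n - 1)"
    then obtain xss where xss: "xss \<in> arrangements_above_1 (t - 1) (n - 1)" "yss = g xss" by blast
    from splitg[OF xss(1)] obtain ys zs where s: "xss = ys @ zs" "length ys = i" by blast
    then show "yss \<in> {xss \<in> K. xss ! i = [1]}"
      using xss singleton_1_in_arrangements[of ys zs t n] assms by (auto simp: g_app K_def nth_append)
  next
    fix yss assume "yss \<in> {xss \<in> K. xss ! i = [1]}"
    then have yss: "yss \<in> arrangements t n" "yss ! i = [1]"
      by (auto simp: K_def)
    from split[OF yss(1)] obtain ys l zs where s: "yss = ys @ l # zs" "length ys = i" by blast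
    then have "yss = ys @ [1] # zs" using yss by (simp add: nth_append)
    then show "yss \<in> g ` arrangements_above_1 (t - 1) (n - 1)"
      using s yss(1) singleton_1_in_arrangements[of ys zs t n]
      by (metis g_app image_eqI)
  qed
  moreover have "inj_on g (arrangements_above_1 (t - 1) (n - 1))"
  proof (rule inj_onI)
    fix xss yss assume "xss \<in> arrangements_above_1 (t - 1) (n - 1)"
      "yss \<in> arrangements_above_1 (t - 1) (n - 1)" and eq: "g xss = g yss"
    then obtain ys zs ys' zs' where s: "xss = ys @ zs" "length ys = i"
      "yss = ys' @ zs'" "length ys' = i" using splitg by metis
    then show "xss = yss" using eq by (auto simp: g_app)
  qed
  ultimately have c2: "card {xss \<in> K. xss ! i = [1]} = card (arrangements_above_1 (t - 1) (n - 1))"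
    by (metis card_image)
  have "finite K" using finite_arrangements by (simp add: K_def)
  moreover have "K = {xss \<in> K. xss ! i \<noteq> [1]} \<union> {xss \<in> K. xss ! i = [1]}" by blast
  ultimately have "card K = card {xss \<in> K. xss ! i \<noteq> [1]} + card {xss \<in> K. xss ! i = [1]}"
    by (metis (no_types, lifting) card_Un_disjoint disjoint_iff finite_Un mem_Collect_eq)
  then show ?thesis unfolding c1 c2 by (simp add: K_def)
qed

text \<open>Both terms of the previous count shift down to the same \<open>n\<close>: the second has
  \<open>t\<close> blocks and sum \<open>n + Suc t - 1 = n + t\<close>.\<close>

lemma card_arrangements_1_in_block:
  assumes "i < Suc t"
  shows "card {xss \<in> arrangements (Suc t) (n + Suc t). 1 \<in> set (xss ! i)} =
    card (arrangements (Suc t) n) + card (arrangements t n)"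
  using card_1_in_block[OF assms, of "n + Suc t"] card_arrangements_above_1[of "Suc t" n]
    card_arrangements_above_1[of t n] by simp

text \<open>Either 1 does not occur, or it lies in exactly one of the \<open>t + 1\<close> blocks;
  the former case supplies the additional 1 in the coefficient \<open>t + 2\<close>.\<close>

lemma card_arrangements_rec:
  "card (arrangements (Suc t) (n + Suc t)) =
     (t + 2) * card (arrangements (Suc t) n) + (t + 1) * card (arrangements t n)"
proof -
  define K where "K i = {xss \<in> arrangements (Suc t) (n + Suc t). 1 \<in> set (xss ! i)}" for i
  have "arrangements (Suc t) (n + Suc t) =
      arrangements_above_1 (Suc t) (n + Suc t) \<union> (\<Union>i<Suc t. K i)"
    by (auto simp: arrangements_above_1_def K_def arrangements_def in_set_conv_nth Bex_def)
  moreover have "arrangements_above_1 (Suc t) (n + Suc t) \<inter> (\<Union>i<Suc t. K i) = {}"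
    by (auto simp: arrangements_above_1_def K_def arrangements_def)
  moreover have "K i \<inter> K j = {}" if "i < Suc t" "j < Suc t" "i \<noteq> j" for i j
  proof -
    have "set (xss ! i) \<inter> set (xss ! j) = {}" if "xss \<in> arrangements (Suc t) (n + Suc t)" for xss
    proof -
      have d: "distinct (concat xss)" "i < length xss" "j < length xss"
        "\<forall>l\<in>set xss. l \<noteq> []"
        using that \<open>i < Suc t\<close> \<open>j < Suc t\<close> by (auto simp: arrangements_def)
      have "xss ! i \<noteq> xss ! j"
      proof -
        \<comment> \<open>\<open>distinct_concat_iff\<close> yields distinct members only after
          empty ones are removed; here there are none.\<close>
        have "removeAll [] xss = xss" using d(4) by (intro removeAll_id) blast
        then have "distinct xss" using d(1) by (simp add: distinct_concat_iff)
        then show ?thesis using d \<open>i \<noteq> j\<close> by (simp add: nth_eq_iff_index_eq)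
      qed
      then show ?thesis using d by (simp add: distinct_concat_iff)
    qed
    then show ?thesis by (auto simp: K_def)
  qed
  moreover have "finite (K i)" for i by (simp add: K_def finite_arrangements)
  moreover have "finite (arrangements_above_1 (Suc t) (n + Suc t))"
    by (simp add: arrangements_above_1_def finite_arrangements)
  ultimately have "card (arrangements (Suc t) (n + Suc t)) =
      card (arrangements_above_1 (Suc t) (n + Suc t)) + (\<Sum>i<Suc t. card (K i))"
    by (subst card_UN_disjoint[symmetric]) (auto simp: card_Un_disjoint)
  also have "(\<Sum>i<Suc t. card (K i)) =
      Suc t * (card (arrangements (Suc t) n) + card (arrangements t n))"
    using card_arrangements_1_in_block[of _ t n] by (simp add: K_def)
  finally show ?thesis using card_arrangements_above_1[of "Suc t" n] by (simp add: algebra_simps)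
qed

subsection \<open>Encoding walks as block arrangements\<close>

text \<open>These are the forced moves before a throw: nothing is thrown until the first position is
  0.\<close>

primrec run :: "nat \<Rightarrow> nat \<Rightarrow> (nat \<times> nat) list" where
  "run 0 e = [(0, e)]"
| "run (Suc m) e = (Suc m, e) # run m e"

text \<open>
  A pair \<open>(e, b)\<close> in the list means that the walk next reaches the state \<open>(0, e)\<close>; the flag
  \<open>b\<close> says whether the thrown ball lands before the other one (the passage then takes
  \<open>d - e\<close> instead of \<open>d\<close> steps).
\<close>

primrec expand :: "nat \<Rightarrow> (nat \<times> bool) list \<Rightarrow> (nat \<times> nat) list" where
  "expand d [] = []"
| "expand d (x # xs) =
     run (if snd x then d - 1 - fst x else d - 1) (fst x) @ expand (fst x) xs"

text \<open>For a flagged entry the bound \<open>fst x < d\<close> makes the truncated difference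
  \<open>d - 1 - fst x\<close> in \<open>expand\<close> exact.\<close>

primrec valid :: "nat \<Rightarrow> (nat \<times> bool) list \<Rightarrow> bool" where
  "valid d [] \<longleftrightarrow> True"
| "valid d (x # xs) \<longleftrightarrow> fst x > 0 \<and> (snd x \<longrightarrow> fst x < d) \<and> valid (fst x) xs"

lemma run_neq_Nil: "run m e \<noteq> []"
  by (cases m) auto

lemma hd_run: "hd (run m e) = (m, e)"
  by (cases m) auto

lemma last_run: "last (run m e) = (0, e)"
  by (induction m) (auto simp: run_neq_Nil)

lemma length_run: "length (run m e) = Suc m"
  by (induction m) auto

lemma set_run: "set (run m e) = {..m} \<times> {e}"
  by (induction m) (auto simp: atMost_Suc)

lemma distinct_run: "distinct (run m e)"
  by (induction m) (auto simp: set_run)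

lemma walk_run_append:
  "e > 0 \<Longrightarrow> walk s (run m e @ vs) \<longleftrightarrow> step s (m, e) \<and> walk (0, e) vs"
  by (induction m arbitrary: s) auto

lemma walk_expand: "d > 0 \<Longrightarrow> valid d xs \<Longrightarrow> walk (0, d) (expand d xs)"
  by (induction xs arbitrary: d) (auto simp: walk_run_append)

text \<open>All moves are forced until the first position is 0, and the condition on the last entry
  keeps the walk from stopping inside the descent.\<close>

lemma walk_descend:
  assumes "walk s ((m, e) # vs)" "fst (last ((m, e) # vs)) = 0"
  shows "\<exists>ws. (m, e) # vs = run m e @ ws \<and> walk (0, e) ws \<and> (ws \<noteq> [] \<longrightarrow> fst (last ws) = 0)"
  using assms
proof (induction m arbitrary: s vs)
  case 0
  then show ?case by (intro exI[of _ vs]) auto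
next
  case (Suc m)
  then obtain v ws where vs: "vs = v # ws" by (cases vs) auto
  then have v: "v = (m, e)" using Suc.prems by (cases v) auto
  with Suc.IH[of "(Suc m, e)" ws] Suc.prems vs show ?case by auto
qed

lemma walk_imp_expand:
  assumes "walk (0, d) vs" "d > 0" "vs \<noteq> [] \<longrightarrow> fst (last vs) = 0"
  shows "\<exists>xs. valid d xs \<and> vs = expand d xs"
  using assms
proof (induction "length vs" arbitrary: d vs rule: less_induct)
  case less
  show ?case
  proof (cases vs)
    case Nil
    then show ?thesis by (intro exI[of _ "[]"]) auto
  next
    case (Cons v us)
    obtain m e where v: "v = (m, e)" by (cases v)
    with less.prems Cons obtain ws where ws: "vs = run m e @ ws" "walk (0, e) ws"
      "ws \<noteq> [] \<longrightarrow> fst (last ws) = 0" using walk_descend[of "(0, d)" m e us] by auto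
    have step: "e > 0" "m = d - 1 \<or> m + e = d - 1" using less.prems v Cons by auto
    have "length ws < length vs" by (simp add: ws length_run)
    then obtain xs where xs: "valid e xs" "ws = expand e xs"
      using less.hyps[of ws e] ws step by blast
    \<comment> \<open>The two landing options exclude each other because \<open>e > 0\<close>, so
      \<open>m\<close> determines the flag.\<close>
    define b where "b \<longleftrightarrow> m \<noteq> d - 1"
    have "m = (if b then d - 1 - e else d - 1)" "b \<longrightarrow> e < d"
      using step by (auto simp: b_def)
    then have "valid d ((e, b) # xs)" "vs = expand d ((e, b) # xs)"
      using step(1) xs ws(1) by simp_all
    then show ?thesis by blast
  qed
qed

text \<open>The first pair of the expansion shows the new distance \<open>e\<close> and the landing
  position; since \<open>e > 0\<close>, the latter reveals the flag.\<close>

lemma expand_inject: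
  assumes "valid d xs" "valid d ys" "expand d xs = expand d ys" "d > 0"
  shows "xs = ys"
  using assms
proof (induction xs arbitrary: d ys)
  case Nil
  then show ?case by (cases ys) (auto simp: run_neq_Nil)
next
  case (Cons x xs)
  then obtain y ys' where ys: "ys = y # ys'" by (cases ys) (auto simp: run_neq_Nil)
  have "hd (expand d (x # xs)) = hd (expand d ys)" using Cons.prems by simp
  then have eq: "fst x = fst y"
      "(if snd x then d - 1 - fst x else d - 1) = (if snd y then d - 1 - fst y else d - 1)"
    by (simp_all add: ys hd_run run_neq_Nil)
  then have "x = y" using Cons.prems ys by (auto simp: prod_eq_iff split: if_splits)
  then show ?case using Cons ys by auto
qed

lemma snd_expand: "snd ` set (expand d xs) = fst ` set xs"
  by (induction xs arbitrary: d) (auto simp: set_run image_Un)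

text \<open>Every run at distance \<open>e\<close> ends in \<open>(0, e)\<close>, so two runs meet
  exactly if their distances agree.\<close>

lemma distinct_expand: "distinct (expand d xs) \<longleftrightarrow> distinct (map fst xs)"
proof (induction xs arbitrary: d)
  case (Cons x xs)
  have "set (run m (fst x)) \<inter> set (expand (fst x) xs) = {} \<longleftrightarrow> fst x \<notin> fst ` set xs" for m
  proof
    assume "fst x \<notin> fst ` set xs"
    then show "set (run m (fst x)) \<inter> set (expand (fst x) xs) = {}"
      unfolding snd_expand[of "fst x", symmetric] by (force simp: set_run)
  next
    assume disj: "set (run m (fst x)) \<inter> set (expand (fst x) xs) = {}"
    have "(0, e) \<in> set (expand d xs)" if "e \<in> fst ` set xs" for e d
      using that by (induction xs arbitrary: d) (auto simp: set_run)
    then show "fst x \<notin> fst ` set xs" using disj by (force simp: set_run)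
  qed
  then show ?case using Cons by (auto simp: distinct_run)
qed simp

lemma last_expand: "xs \<noteq> [] \<Longrightarrow> last (expand d xs) = (0, fst (last xs))"
proof (induction xs arbitrary: d)
  case (Cons x xs)
  have "expand d xs \<noteq> []" if "xs \<noteq> []" for d using that by (cases xs) (auto simp: run_neq_Nil)
  then show ?case using Cons by (auto simp: last_append last_run)
qed simp

text \<open>Consecutive short throws telescope.\<close>

lemma length_expand:
  "d > 0 \<Longrightarrow> valid d xs \<Longrightarrow>
     length (expand d xs) + last (d # map fst xs) =
     d + sum_list (map fst (filter (\<lambda>x. \<not> snd x) xs))"
proof (induction xs arbitrary: d)
  case (Cons x xs)
  have "length (expand (fst x) xs) + last (fst x # map fst xs) =
      fst x + sum_list (map fst (filter (\<lambda>x. \<not> snd x) xs))"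
    using Cons by simp
  moreover have "last (d # map fst (x # xs)) = last (fst x # map fst xs)" by simp
  \<comment> \<open>This \<open>k\<close> is the truncated difference \<open>d - 1 - fst x\<close>;
    naming it makes the cancellation linear.\<close>
  moreover have "\<exists>k. d = Suc (fst x + k)" if "snd x"
    using that Cons.prems by (auto intro: less_imp_Suc_add)
  ultimately show ?case
    using Cons.prems by (cases "snd x") (auto simp: length_run simp del: last.simps)
qed simp

text \<open>Start and end distance are both 1, so the boundary terms in \<open>length_expand\<close>
  cancel and the unflagged sum is the length of the walk.\<close>

definition flagged :: "nat \<Rightarrow> (nat \<times> bool) list set" where
  "flagged n = {xs. valid 1 xs \<and> xs \<noteq> [] \<and> fst (last xs) = 1 \<and> distinct (map fst xs) \<and>
     sum_list (map fst (filter (\<lambda>x. \<not> snd x) xs)) = n}"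

lemma card_ground_walks: "card (ground_walks n) = card (flagged n)"
proof -
  have len: "length (expand 1 xs) = sum_list (map fst (filter (\<lambda>x. \<not> snd x) xs))"
    if "valid 1 xs" "xs \<noteq> []" "fst (last xs) = 1" for xs
    using length_expand[of 1 xs] that by (simp add: last_map)
  have ne: "expand 1 xs \<noteq> [] \<longleftrightarrow> xs \<noteq> []" for xs
    by (cases xs) (auto simp: run_neq_Nil)
  have "bij_betw (expand 1) (flagged n) (ground_walks n)"
    unfolding bij_betw_def
  proof
    show "inj_on (expand 1) (flagged n)"
      by (rule inj_onI) (auto simp: flagged_def intro: expand_inject[of 1])
    show "expand 1 ` flagged n = ground_walks n"
    proof (intro equalityI subsetI)
      fix vs assume "vs \<in> expand 1 ` flagged n"
      then show "vs \<in> ground_walks n"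
        using len ne walk_expand[of 1] last_expand[of _ 1]
        by (auto simp: flagged_def ground_walks_def distinct_expand)
    next
      fix vs assume vs: "vs \<in> ground_walks n"
      then obtain xs where xs: "valid 1 xs" "vs = expand 1 xs"
        using walk_imp_expand[of 1 vs] by (auto simp: ground_walks_def)
      have "xs \<noteq> []" using vs xs ne[of xs] by (simp add: ground_walks_def)
      moreover have "fst (last xs) = 1"
        using last_expand[OF \<open>xs \<noteq> []\<close>, of 1] vs xs by (simp add: ground_walks_def)
      ultimately have "xs \<in> flagged n"
        using vs xs len[of xs] distinct_expand[of 1 xs] by (simp add: flagged_def ground_walks_def)
      then show "vs \<in> expand 1 ` flagged n" using xs by blast
    qed
  qed
  then show ?thesis by (simp add: bij_betw_same_card)
qed

text \<open>
  Unflagged entries start the blocks, so the unflagged sum becomes the sum of the block maxima.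
\<close>

definition mark :: "nat list \<Rightarrow> (nat \<times> bool) list" where
  "mark l = (hd l, False) # map (\<lambda>e. (e, True)) (tl l)"

text \<open>This is a left inverse of concatenating marked blocks. The first component holds the
  flagged entries before the first unflagged one, which still wait for the head of their
  block.\<close>

primrec split_flags :: "(nat \<times> bool) list \<Rightarrow> nat list \<times> nat list list" where
  "split_flags [] = ([], [])"
| "split_flags (x # xs) = (let (ys, yss) = split_flags xs in
     if snd x then (fst x # ys, yss) else ([], (fst x # ys) # yss))"

lemma split_flags_append:
  "split_flags (map (\<lambda>e. (e, True)) ys @ xs) =
     (ys @ fst (split_flags xs), snd (split_flags xs))"
  by (induction ys) (auto simp: case_prod_beta)

lemma split_flags_marks:
  "\<forall>l\<in>set yss. l \<noteq> [] \<Longrightarrow> split_flags (concat (map mark yss)) = ([], yss)"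
  by (induction yss) (auto simp: mark_def split_flags_append)

lemma valid_append:
  "valid d (xs @ ys) \<longleftrightarrow> valid d xs \<and> valid (last (d # map fst xs)) ys"
  by (induction xs arbitrary: d) auto

text \<open>Each flagged entry is below its predecessor, which by transitivity is a strict descent
  from \<open>d\<close>.\<close>

lemma valid_linked:
  "valid d (map (\<lambda>e. (e, True)) ys) \<longleftrightarrow> sorted_wrt (>) (d # ys) \<and> 0 \<notin> set ys"
proof (induction ys arbitrary: d)
  case (Cons y ys)
  then show ?case by fastforce
qed simp

lemma valid_marks:
  assumes "\<forall>l\<in>set yss. l \<noteq> [] \<and> sorted_wrt (>) l" "0 \<notin> set (concat yss)"
  shows "valid d (concat (map mark yss))"
  using assms
proof (induction yss arbitrary: d)
  case (Cons l yss)
  then obtain y ys where "l = y # ys" by (cases l) auto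
  then show ?case using Cons by (auto simp: mark_def valid_append valid_linked)
qed simp

lemma valid_pos: "valid d xs \<Longrightarrow> 0 \<notin> fst ` set xs"
  by (induction xs arbitrary: d) auto

text \<open>The prefix \<open>ys\<close> continues a block opened before the list begins; it is what
  lets the induction pass through an arbitrary \<open>d\<close>.\<close>

lemma valid_imp_marks:
  assumes "valid d xs"
  shows "\<exists>ys yss. xs = map (\<lambda>e. (e, True)) ys @ concat (map mark yss) \<and>
    sorted_wrt (>) (d # ys) \<and> (\<forall>l\<in>set yss. l \<noteq> [] \<and> sorted_wrt (>) l)"
  using assms
proof (induction xs arbitrary: d)
  case Nil
  then show ?case by (intro exI[of _ "[]"]) auto
next
  case (Cons x xs)
  then obtain ys yss where xs: "xs = map (\<lambda>e. (e, True)) ys @ concat (map mark yss)"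
    "sorted_wrt (>) (fst x # ys)" "\<forall>l\<in>set yss. l \<noteq> [] \<and> sorted_wrt (>) l"
  proof -
    have "valid (fst x) xs" using Cons.prems by simp
    from Cons.IH[OF this] show thesis using that by blast
  qed
  show ?case
  proof (cases "snd x")
    case True
    then have "x = (fst x, True)" by (simp add: prod_eq_iff)
    then show ?thesis using xs Cons.prems
      by (intro exI[of _ "fst x # ys"] exI[of _ yss]) (auto simp: prod_eq_iff)
  next
    case False
    then have "x = (fst x, False)" by (simp add: prod_eq_iff)
    then show ?thesis using xs
      by (intro exI[of _ "[] :: nat list"] exI[of _ "(fst x # ys) # yss"])
        (auto simp: mark_def[of "fst x # ys"] prod_eq_iff)
  qed
qed

lemma map_fst_marks:
  "\<forall>l\<in>set yss. l \<noteq> [] \<Longrightarrow> map fst (concat (map mark yss)) = concat yss"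
  by (induction yss) (auto simp: mark_def comp_def)

lemma sum_marks:
  "sum_list (map fst (filter (\<lambda>x. \<not> snd x) (concat (map mark yss)))) = sum_list (map hd yss)"
  by (induction yss) (auto simp: mark_def filter_map comp_def)

section \<open>Arrangements with 1 in the last block\<close>

definition ground_arrangements :: "nat \<Rightarrow> nat list list set" where
  "ground_arrangements n = {yss. yss \<in> arrangements (length yss) n \<and> yss \<noteq> [] \<and> 1 \<in> set (last yss)}"

lemma last_concat: "xss \<noteq> [] \<Longrightarrow> last xss \<noteq> [] \<Longrightarrow> last (concat xss) = last (last xss)"
  by (induction xss rule: rev_induct) auto

text \<open>As the least admissible entry, 1 can only stand at the end of its decreasing
  block.\<close>

lemma last_1_iff:
  assumes "yss \<in> arrangements t n" "yss \<noteq> []"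
  shows "last (concat yss) = 1 \<longleftrightarrow> 1 \<in> set (last yss)"
proof -
  have "last yss \<in> set yss" using assms by simp
  then have *: "last yss \<noteq> []" "sorted_wrt (>) (last yss)" "0 \<notin> set (last yss)"
    using assms(1) unfolding arrangements_def by auto
  then show ?thesis
    using last_eq_1_if_decreasing[of "last yss"] last_concat[OF assms(2)] last_in_set by metis
qed

lemma card_flagged: "card (flagged n) = card (ground_arrangements n)"
proof -
  let ?f = "\<lambda>yss. concat (map mark yss)"
  have iff: "?f yss \<in> flagged n \<longleftrightarrow> yss \<in> ground_arrangements n"
    if blocks: "\<forall>l\<in>set yss. l \<noteq> [] \<and> sorted_wrt (>) l" for yss
  proof -
    have fst: "map fst (?f yss) = concat yss" using blocks map_fst_marks by blast
    have ne: "?f yss \<noteq> [] \<longleftrightarrow> yss \<noteq> []" by (cases yss) (auto simp: mark_def)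
    have pos: "valid 1 (?f yss) \<longleftrightarrow> 0 \<notin> set (concat yss)"
      using valid_marks[of yss 1] valid_pos[of 1 "?f yss"] blocks unfolding fst[symmetric] by auto
    have last: "fst (last (?f yss)) = last (concat yss)" if "yss \<noteq> []"
      using ne that fst last_map by metis
    show ?thesis
    proof (cases "yss = []")
      case True
      then show ?thesis by (simp add: flagged_def ground_arrangements_def)
    next
      case False
      have "?f yss \<in> flagged n \<longleftrightarrow> yss \<in> arrangements (length yss) n \<and> last (concat yss) = 1"
        unfolding flagged_def mem_Collect_eq sum_marks fst pos last[OF False] ne
        using False blocks by (auto simp: arrangements_def)
      then show ?thesis
        using False last_1_iff[of yss "length yss" n] by (auto simp: ground_arrangements_def)
    qed
  qed
  have blocks: "\<forall>l\<in>set yss. l \<noteq> [] \<and> sorted_wrt (>) l" if "yss \<in> ground_arrangements n" for yss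
    using that by (auto simp: ground_arrangements_def arrangements_def)
  have "bij_betw ?f (ground_arrangements n) (flagged n)"
    unfolding bij_betw_def
  proof
    show "inj_on ?f (ground_arrangements n)"
    proof (rule inj_onI)
      fix yss zss
      assume yz: "yss \<in> ground_arrangements n" "zss \<in> ground_arrangements n" "?f yss = ?f zss"
      have "split_flags (?f yss) = ([], yss)" "split_flags (?f zss) = ([], zss)"
        using blocks[OF yz(1)] blocks[OF yz(2)] by (intro split_flags_marks; blast)+
      then show "yss = zss" unfolding yz(3) by simp
    qed
    show "?f ` ground_arrangements n = flagged n"
    proof (intro equalityI subsetI)
      fix xs assume "xs \<in> ?f ` ground_arrangements n"
      then show "xs \<in> flagged n" using iff blocks by blast
    next
      fix xs assume xs: "xs \<in> flagged n"
      then have v: "valid 1 xs" by (simp add: flagged_def)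
      from valid_imp_marks[OF v] obtain ys yss where
        s: "xs = map (\<lambda>e. (e, True)) ys @ ?f yss" "sorted_wrt (>) (1 # ys)"
          "\<forall>l\<in>set yss. l \<noteq> [] \<and> sorted_wrt (>) l" by blast
      \<comment> \<open>The flagged prefix lies strictly below the start distance 1 and contains no
        0, so it is empty and the blocks exhaust the list.\<close>
      have "0 \<notin> set ys" using valid_pos[OF v] by (force simp: s(1))
      then have "ys = []" using s(2) by (cases ys) auto
      then have "xs = ?f yss" using s(1) by simp
      then show "xs \<in> ?f ` ground_arrangements n" using iff[OF s(3)] xs by blast
    qed
  qed
  then show ?thesis by (simp add: bij_betw_same_card)
qed

text \<open>Split by the number \<open>t + 1\<close> of blocks, which is at most \<open>n\<close>;
  the last block then has index \<open>t\<close>, and the count with 1 in a prescribed block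
  applies.\<close>

lemma B_eq_sum:
  "B n = (\<Sum>t<n. card (arrangements (Suc t) (n - Suc t)) + card (arrangements t (n - Suc t)))"
proof -
  define K where "K t = {xss \<in> arrangements (Suc t) n. 1 \<in> set (xss ! t)}" for t
  have "ground_arrangements n = (\<Union>t<n. K t)"
  proof (intro equalityI subsetI)
    fix xss assume xss: "xss \<in> ground_arrangements n"
    then obtain t where t: "length xss = Suc t"
      by (cases "length xss") (auto simp: ground_arrangements_def)
    then have "xss \<in> K t"
      using xss by (auto simp: K_def ground_arrangements_def last_conv_nth)
    moreover have "t < n"
      using arrangements_empty[of n "Suc t"] xss t by (force simp: ground_arrangements_def)
    ultimately show "xss \<in> (\<Union>t<n. K t)" by blast
  next
    fix xss assume "xss \<in> (\<Union>t<n. K t)"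
    then obtain t where t: "xss \<in> arrangements (Suc t) n" "1 \<in> set (xss ! t)"
      by (auto simp: K_def)
    then have "length xss = Suc t" by (simp add: arrangements_def)
    then have "xss \<noteq> []" "last xss = xss ! t" using last_conv_nth[of xss] by fastforce+
    then show "xss \<in> ground_arrangements n"
      using t \<open>length xss = Suc t\<close> by (simp add: ground_arrangements_def)
  qed
  moreover have "card (\<Union>t<n. K t) = (\<Sum>t<n. card (K t))"
  proof (rule card_UN_disjoint)
    show "\<forall>t\<in>{..<n}. finite (K t)" by (simp add: K_def finite_arrangements)
    show "\<forall>t\<in>{..<n}. \<forall>u\<in>{..<n}. t \<noteq> u \<longrightarrow> K t \<inter> K u = {}"
      by (auto simp: K_def arrangements_def)
  qed simp
  moreover have "card (K t) = card (arrangements (Suc t) (n - Suc t)) + card (arrangements t (n - Suc t))"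
    if "t < n" for t
    using card_arrangements_1_in_block[of t t "n - Suc t"] that by (simp add: K_def)
  ultimately show ?thesis
    by (simp add: B_eq_card_cycles card_cycles_eq_ground_walks card_ground_walks card_flagged)
qed

subsection \<open>Asymptotics\<close>

definition density :: "nat \<Rightarrow> nat \<Rightarrow> real" where
  "density t n = real (card (arrangements t n)) / 2 ^ n"

lemma density_nonneg: "density t n \<ge> 0"
  by (simp add: density_def)

lemma density_0: "density 0 n = (if n = 0 then 1 else 0)"
  by (simp add: density_def arrangements_0)

lemma density_eq_0: "n < t \<Longrightarrow> density t n = 0"
  by (simp add: density_def arrangements_empty)

lemma density_rec:
  "density (Suc t) (n + Suc t) =
     ((real t + 2) * density (Suc t) n + (real t + 1) * density t n) / 2 ^ Suc t"
proof -
  have "density (Suc t) (n + Suc t) =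
      (real (t + 2) * real (card (arrangements (Suc t) n)) +
       real (t + 1) * real (card (arrangements t n))) / 2 ^ (n + Suc t)"
    unfolding density_def card_arrangements_rec of_nat_add of_nat_mult by simp
  also have "\<dots> = (real (t + 2) * density (Suc t) n + real (t + 1) * density t n) / 2 ^ Suc t"
    by (simp add: density_def power_add field_simps)
  finally show ?thesis by (simp add: add.commute)
qed

lemma q_1: "q (Suc 0) = 1 / 2"
  by (simp add: q_def)

text \<open>This makes the denominators in \<open>q\<close> positive and the coefficient
  \<open>(t + 2) / 2 ^ Suc t\<close> of the density recurrence less than 1.\<close>

lemma two_power_gt: "real t + 2 < 2 ^ Suc t" if "t > 0"
proof -
  have "t + 2 < 2 ^ Suc t" using that
  proof (induction t)
    case (Suc t) then show ?case by (cases t) auto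
  qed simp
  then have "real (t + 2) < real (2 ^ Suc t)" by (simp only: of_nat_less_iff)
  then show ?thesis by simp
qed

lemma q_Suc: "q (Suc t) = q t * (real t / (2 ^ Suc t - real t - 2))" if "t > 0"
proof -
  have "{2..Suc t} = insert (Suc t) {2..t}" using that by auto
  then show ?thesis by (simp add: q_def algebra_simps)
qed

lemma q_pos: "q t > 0"
proof -
  have "0 < (real i - 1) / (2 ^ i - real i - 1)" if "i \<ge> 2" for i
    using that two_power_gt[of "i - 1"] by (auto simp: of_nat_diff)
  then show ?thesis unfolding q_def by (intro mult_pos_pos prod_pos) auto
qed

text \<open>The proposed limits are a fixed point of the density recurrence; this is what the
  denominators in \<open>q\<close> encode.\<close>

lemma density_limit_eq:
  assumes "t > 0"
  shows "((real t + 2) * (real (Suc t) * q (Suc t)) + (real t + 1) * (real t * q t)) / 2 ^ Suc t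
    = real (Suc t) * q (Suc t)"
proof -
  define D where "D = 2 ^ Suc t - real t - 2"
  have "D > 0" using two_power_gt[OF assms] by (simp add: D_def)
  have eq: "2 ^ Suc t = D + real t + 2" by (simp add: D_def)
  have "q (Suc t) * D = q t * real t"
    using q_Suc[OF assms] \<open>D > 0\<close> by (simp add: D_def)
  then have "(real t + 2) * (real (Suc t) * q (Suc t)) + (real t + 1) * (real t * q t) =
      real (Suc t) * q (Suc t) * 2 ^ Suc t"
    unfolding eq by (simp add: algebra_simps)
  then show ?thesis by simp
qed

text \<open>With one block the recurrence has leading coefficient 2/2 = 1 and does not contract, so
  this base case is computed directly.\<close>

lemma density_1: "density (Suc 0) n = (if n = 0 then 0 else 1 / 2)"
proof (induction n)
  case 0 then show ?case by (simp add: density_eq_0)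
next
  case (Suc n)
  show ?case using density_rec[of 0 n] Suc by (auto simp: density_0)
qed

text \<open>The recurrence has nonnegative coefficients and fixes the claimed bounds, so these
  bounds propagate from smaller \<open>t\<close> and \<open>n\<close>.\<close>

lemma density_le: "density (Suc t) n \<le> real (Suc t) * q (Suc t)"
proof (induction t arbitrary: n)
  case 0 then show ?case by (simp add: density_1 q_1)
next
  case (Suc t)
  show ?case
  proof (induction n rule: less_induct)
    case (less n)
    show ?case
    proof (cases "n < Suc (Suc t)")
      case True
      then show ?thesis using q_pos[of "Suc (Suc t)"] by (simp add: density_eq_0)
    next
      case False
      then obtain m where n: "n = m + Suc (Suc t)" by (metis add.commute le_Suc_ex not_less)
      have "density (Suc (Suc t)) n \<le> ((real (Suc t) + 2) * (real (Suc (Suc t)) * q (Suc (Suc t)))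
          + (real (Suc t) + 1) * (real (Suc t) * q (Suc t))) / 2 ^ Suc (Suc t)"
        unfolding n density_rec using less.IH[of m] Suc.IH[of m] n
        by (intro divide_right_mono add_mono mult_left_mono) auto
      then show ?thesis using density_limit_eq[of "Suc t"] by simp
    qed
  qed
qed

text \<open>Compare the recurrence at \<open>n\<close> and at \<open>n + 1\<close>: its coefficients
  are nonnegative, and it starts from densities that vanish.\<close>

lemma density_mono: "incseq (density (Suc t))"
proof (induction t)
  case 0 then show ?case by (auto simp: density_1 incseq_def)
next
  case (Suc t)
  have "density (Suc (Suc t)) n \<le> density (Suc (Suc t)) (Suc n)" for n
  proof (induction n rule: less_induct)
    case (less n)
    show ?case
    proof (cases "n < Suc (Suc t)")
      case True
      then show ?thesis using density_nonneg by (simp add: density_eq_0)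
    next
      case False
      then obtain m where n: "n = m + Suc (Suc t)" by (metis add.commute le_Suc_ex not_less)
      then have n': "Suc n = Suc m + Suc (Suc t)" by simp
      show ?thesis
        unfolding n' unfolding n density_rec
        using less.IH[of m] incseq_SucD[OF Suc.IH, of m] n
        by (intro divide_right_mono add_mono mult_left_mono) auto
    qed
  qed
  then show ?case by (rule incseq_SucI)
qed

lemma affine_fixpoint_unique:
  fixes l :: real
  assumes "(a * l + c) / p = l" "(a * l' + c) / p = l'" "a < p" "p > 0"
  shows "l = l'"
proof -
  have "a * l + c = p * l" "a * l' + c = p * l'" using assms by (auto simp: divide_eq_eq mult.commute)
  then have "(p - a) * (l - l') = 0" by (simp add: algebra_simps)
  then show ?thesis using assms by simp
qed

text \<open>Monotonicity and the upper bound give some limit; letting \<open>n\<close> grow in the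
  recurrence identifies it as the unique fixed point.\<close>

lemma density_tendsto: "density (Suc t) \<longlonglongrightarrow> real (Suc t) * q (Suc t)"
proof (induction t)
  case 0
  have "\<forall>\<^sub>F n in sequentially. density (Suc 0) n = 1 / 2"
    using eventually_gt_at_top[of 0] by eventually_elim (simp add: density_1)
  then show ?case by (simp add: q_1 tendsto_eventually)
next
  case (Suc t)
  obtain l where l: "density (Suc (Suc t)) \<longlonglongrightarrow> l"
    using incseq_convergent[OF density_mono] density_le by metis
  have "(\<lambda>n. density (Suc (Suc t)) (n + Suc (Suc t))) \<longlonglongrightarrow>
      ((real (Suc t) + 2) * l + (real (Suc t) + 1) * (real (Suc t) * q (Suc t))) / 2 ^ Suc (Suc t)"
    unfolding density_rec by (intro tendsto_intros l Suc) auto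
  moreover have "(\<lambda>n. density (Suc (Suc t)) (n + Suc (Suc t))) \<longlonglongrightarrow> l"
    using LIMSEQ_ignore_initial_segment[OF l] .
  ultimately have "((real (Suc t) + 2) * l + (real (Suc t) + 1) * (real (Suc t) * q (Suc t)))
      / 2 ^ Suc (Suc t) = l"
    using LIMSEQ_unique by blast
  then have "l = real (Suc (Suc t)) * q (Suc (Suc t))"
    using density_limit_eq[of "Suc t"] two_power_gt[of "Suc t"]
    by (intro affine_fixpoint_unique[of "real (Suc t) + 2" l
        "(real (Suc t) + 1) * (real (Suc t) * q (Suc t))" "2 ^ Suc (Suc t)"]) simp_all
  then show ?case using l by simp
qed

section \<open>Summability and the interchange of limit and sum\<close>

lemma density_limit_le_1: "real (Suc t) * q (Suc t) \<le> 1"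
proof (induction t)
  case 0 then show ?case by (simp add: q_1)
next
  case (Suc t)
  show ?case
  proof (cases "t = 0")
    case True then show ?thesis using q_Suc[of 1] by (simp add: q_1)
  next
    case False
    \<comment> \<open>This says that the ratio of consecutive bounds is at most 1. It fails for
      \<open>t = 0\<close>, where the bound to be shown holds with equality.\<close>
    have "2 * t + 5 \<le> 2 ^ Suc (Suc t)" using False
    proof (induction t)
      case (Suc t) then show ?case by (cases t) auto
    qed simp
    then have "real (2 * t + 5) \<le> real (2 ^ Suc (Suc t))" by (simp only: of_nat_le_iff)
    then have "real (Suc (Suc t)) / (2 ^ Suc (Suc t) - real (Suc t) - 2) \<le> 1"
      by simp
    moreover have "real (Suc (Suc t)) / (2 ^ Suc (Suc t) - real (Suc t) - 2) \<ge> 0"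
      using two_power_gt[of "Suc t"] by simp
    ultimately have "real (Suc (Suc t)) / (2 ^ Suc (Suc t) - real (Suc t) - 2) *
        (real (Suc t) * q (Suc t)) \<le> 1"
      using q_pos[of "Suc t"] by (intro mult_le_one Suc) simp_all
    then show ?thesis using q_Suc[of "Suc t"] by (simp add: mult.commute mult.left_commute)
  qed
qed

lemma summable_gamma: "summable (\<lambda>t. real (Suc t) * q (Suc t) / 2 ^ Suc t)"
proof (rule summable_comparison_test)
  show "summable (\<lambda>t. (1 / 2 :: real) ^ Suc t)" by (simp add: summable_geometric)
  have "\<bar>real (Suc t) * q (Suc t)\<bar> / 2 ^ Suc t \<le> 1 / 2 ^ Suc t" for t
    using density_limit_le_1[of t] q_pos[of "Suc t"] by (intro divide_right_mono) auto
  then show "\<exists>N. \<forall>t\<ge>N. norm (real (Suc t) * q (Suc t) / 2 ^ Suc t) \<le> (1 / 2) ^ Suc t"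
    by (simp add: abs_divide power_one_over abs_mult)
qed

text \<open>The second summand is half of the same series with shifted index, whence the factor
  3/2.\<close>

lemma gamma_sum:
  "(\<Sum>t. (real (Suc t) * q (Suc t) + real t * q t) / 2 ^ Suc t) = gamma_B"
proof -
  define S where "S = (\<Sum>t. real (Suc t) * q (Suc t) / 2 ^ Suc t)"
  have S: "(\<lambda>t. real (Suc t) * q (Suc t) / 2 ^ Suc t) sums S"
    using summable_gamma by (simp add: S_def summable_sums)
  \<comment> \<open>The index shift adds only the term at \<open>t = 0\<close>, which is 0.\<close>
  then have "(\<lambda>t. real t * q t / 2 ^ t) sums S"
    by (subst (asm) sums_Suc_iff) simp
  then have "(\<lambda>t. real t * q t / 2 ^ t / 2) sums (S / 2)" by (rule sums_divide)
  from sums_add[OF S this] have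
    "(\<lambda>t. (real (Suc t) * q (Suc t) + real t * q t) / 2 ^ Suc t) sums (S + S / 2)"
    by (simp add: add_divide_distrib mult.commute)
  then show ?thesis by (simp add: sums_iff gamma_B_def S_def)
qed

lemma sum_density_tendsto:
  "(\<lambda>n. \<Sum>t<n. (density (Suc t) (n - Suc t) + density t (n - Suc t)) / 2 ^ Suc t)
     \<longlonglongrightarrow> gamma_B"
proof -
  \<comment> \<open>Padding with zeros turns sums of growing length into series over all
    \<open>t\<close>, as Tannery's theorem requires.\<close>
  define a where "a t n =
    (if t < n then (density (Suc t) (n - Suc t) + density t (n - Suc t)) / 2 ^ Suc t else 0)" for t n
  have lim: "(\<lambda>n. density t (n - Suc t)) \<longlonglongrightarrow> real t * q t" for t
  proof (cases t)
    case 0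
    have "\<forall>\<^sub>F n in sequentially. density 0 (n - Suc 0) = 0"
      using eventually_gt_at_top[of 1] by eventually_elim (simp add: density_0)
    then show ?thesis using 0 by (simp add: tendsto_eventually)
  next
    case (Suc u)
    have "(\<lambda>n. density (Suc u) (n - Suc (Suc u))) \<longlonglongrightarrow> real (Suc u) * q (Suc u)"
      by (rule filterlim_compose[OF density_tendsto filterlim_minus_const_nat_at_top])
    then show ?thesis by (simp add: Suc)
  qed
  have limS: "(\<lambda>n. density (Suc t) (n - Suc t)) \<longlonglongrightarrow> real (Suc t) * q (Suc t)" for t
    by (rule filterlim_compose[OF density_tendsto filterlim_minus_const_nat_at_top])
  have "(\<lambda>n. a t n) \<longlonglongrightarrow> (real (Suc t) * q (Suc t) + real t * q t) / 2 ^ Suc t" for t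
  proof (rule Lim_transform_eventually)
    show "(\<lambda>n. (density (Suc t) (n - Suc t) + density t (n - Suc t)) / 2 ^ Suc t) \<longlonglongrightarrow>
        (real (Suc t) * q (Suc t) + real t * q t) / 2 ^ Suc t"
      by (intro tendsto_intros lim limS) auto
    show "\<forall>\<^sub>F n in sequentially.
        (density (Suc t) (n - Suc t) + density t (n - Suc t)) / 2 ^ Suc t = a t n"
      using eventually_gt_at_top[of t] by eventually_elim (simp add: a_def)
  qed
  moreover have dle: "density t n \<le> 1" for t n
    using density_le density_limit_le_1 by (cases t) (auto simp: density_0 intro: order_trans)
  have "\<bar>a t n\<bar> \<le> (1 / 2) ^ t" for t n
  proof -
    \<comment> \<open>Both densities are at most 1, so the geometric majorant does not depend on
      \<open>n\<close>.\<close>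
    have "(density (Suc t) (n - Suc t) + density t (n - Suc t)) / 2 ^ Suc t \<le> 2 / 2 ^ Suc t"
      using dle[of "Suc t" "n - Suc t"] dle[of t "n - Suc t"] by (intro divide_right_mono) auto
    then show ?thesis using density_nonneg by (simp add: a_def power_one_over)
  qed
  then have "\<forall>\<^sub>F (t, n) in at_top \<times>\<^sub>F sequentially. norm (a t n) \<le> (1 / 2) ^ t"
    unfolding real_norm_def by (intro always_eventually) simp
  ultimately have "(\<lambda>n. \<Sum>t. a t n) \<longlonglongrightarrow>
      (\<Sum>t. (real (Suc t) * q (Suc t) + real t * q t) / 2 ^ Suc t)"
    using tannerys_theorem[of a "\<lambda>t. (real (Suc t) * q (Suc t) + real t * q t) / 2 ^ Suc t"
        sequentially "\<lambda>t. (1 / 2) ^ t"]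
    by (simp add: summable_geometric)
  moreover have "(\<Sum>t. a t n) =
      (\<Sum>t<n. (density (Suc t) (n - Suc t) + density t (n - Suc t)) / 2 ^ Suc t)" for n
    by (subst suminf_finite[of "{..<n}"]) (auto simp: a_def)
  ultimately show ?thesis unfolding gamma_sum by (simp only:)
qed

lemma gamma_B_pos: "gamma_B > 0"
  unfolding gamma_B_def by (intro mult_pos_pos suminf_pos summable_gamma) (simp_all add: q_pos)

lemma gamma_B_eq: "gamma_B = 3 / 4 * (\<Sum>t. real (Suc t) *
      (1 / 2 ^ Suc t * (\<Prod>i=2..Suc t. (real i - 1) / (2 ^ i - real i - 1))))"
proof -
  \<comment> \<open>Taking the factor 1/2 out of \<open>q\<close> turns 3/2 into 3/4.\<close>
  have "(\<lambda>t. real (Suc t) * (1 / 2 ^ Suc t * (\<Prod>i=2..Suc t. (real i - 1) / (2 ^ i - real i - 1))))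
      = (\<lambda>t. 2 * (real (Suc t) * q (Suc t) / 2 ^ Suc t))"
    by (simp add: q_def)
  then show ?thesis
    using suminf_mult[OF summable_gamma, of 2] by (simp only: gamma_B_def)
qed

text \<open>In \<open>2 ^ n = 2 ^ (n - Suc t) * 2 ^ Suc t\<close> the first factor normalises the
  counts and the second becomes the weight of the term.\<close>

lemma B_density:
  "real (B n) / 2 ^ n =
     (\<Sum>t<n. (density (Suc t) (n - Suc t) + density t (n - Suc t)) / 2 ^ Suc t)"
proof -
  have "(2 :: real) ^ n = 2 ^ (n - Suc t) * 2 ^ Suc t" if "t < n" for t
    using that by (metis Suc_leI le_add_diff_inverse2 power_add)
  then show ?thesis
    by (simp add: B_eq_sum sum_divide_distrib density_def add_divide_distrib del: power_Suc)
qed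

theorem theorem7p5:
  shows "summable (\<lambda>t. real (Suc t) * q (Suc t) / 2 ^ Suc t) \<and>
    gamma_B = 3 / 4 * (\<Sum>t. real (Suc t) *
      (1 / 2 ^ Suc t * (\<Prod>i=2..Suc t. (real i - 1) / (2 ^ i - real i - 1)))) \<and>
    (\<lambda>n. real (B n)) \<sim>[at_top] (\<lambda>n. gamma_B * 2 ^ n)"
proof (intro conjI summable_gamma gamma_B_eq asymp_equivI')
  have "(\<lambda>n. real (B n) / 2 ^ n / gamma_B) \<longlonglongrightarrow> gamma_B / gamma_B"
    using sum_density_tendsto gamma_B_pos unfolding B_density by (intro tendsto_intros) auto
  then show "(\<lambda>n. real (B n) / (gamma_B * 2 ^ n)) \<longlonglongrightarrow> 1"
    using gamma_B_pos by (simp add: mult.commute)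
qed

end
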